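(* Let $G$ be a graph (with symmetric vertex potential) equipped with a non-trivial involution $\phi$, let $S$ be the set of fixed vertices of $\phi$, and let $G'$ be a half graph induced by $\phi$. Let $M$ be the matrix whose columns are, in this order, the vectors in $\mathcal{B}=\left\{\frac{1}{\sqrt2}(\mathbf{e}_u-\mathbf{e}_{\phi(u)}) : u\in V(G')\right\}$, $\mathcal{C}=\left\{\frac{1}{\sqrt2}(\mathbf{e}_u+\mathbf{e}_{\phi(u)}) : u\in V(G')\right\}$ and $\mathcal{D}=\{\mathbf{e}_u : u\in S\}$. Let $\mathscr{L}$ be the $q$-Laplacian matrix of $G$, with blocks $\mathscr{L}',A_\phi,A_S,\mathscr{L}_S$, and put $$\mathscr{L}_-=\mathscr{L}'-A_\phi,\qquad \widetilde{\mathscr{L}_+}=\begin{bmatrix}\mathscr{L}'+A_\phi & \sqrt2\,A_S\\ \sqrt2\,A_S^T & \mathscr{L}_S\end{bmatrix}.$$ Then for every $t\in\mathbb{R}$, $$M^T U_{\mathscr{L}}(t) M=\begin{bmatrix}U_{\mathscr{L}_-}(t) & \mathbf{0}\\ \mathbf{0} & U_{\widetilde{\mathscr{L}_+}}(t)\end{bmatrix}.$$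
   Context: $G$ is a finite undirected graph with positive real edge weights, adjacency matrix $A$ and diagonal degree matrix $\Delta$ (row sums of $A$). An involution $\phi$ of $G$ is an automorphism (preserving edge weights) of order two. The vertices carry a real potential $\eta:V(G)\to\mathbb{R}$ with $\eta(v)=\eta(\phi(v))$ for all $v$, and $\Delta'$ is the diagonal matrix with $\Delta'_{vv}=\eta(v)$. For a non-zero real number $q$, the $q$-Laplacian matrix of $G$ is $\mathscr{L}=(1-q^2)I+q^2(\Delta+\Delta')-qA$. Let $S=\{v:\phi(v)=v\}$. A half graph $G'$ induced by $\phi$ is the induced subgraph on a set $V(G')$ obtained by choosing exactly one vertex from each orbit $\{v,\phi(v)\}$ with $v\notin S$. Order the vertices of $G$ as $V(G')$, then $\phi(V(G'))$ (in the corresponding order), then $S$; then $$\mathscr{L}=\begin{bmatrix}\mathscr{L}' & A_\phi & A_S\\ A_\phi & \mathscr{L}' & A_S\\ A_S^T & A_S^T & \mathscr{L}_S\end{bmatrix},$$ which defines the blocks $\mathscr{L}'$ (indexed by $V(G')$, using degrees and potentials in $G$), $A_\phi$ (symmetric; edges between $V(G')$ and $\phi(V(G'))$), $A_S$ (edges between $V(G')$ and $S$), $\mathscr{L}_S$ (indexed by $S$, using degrees and potentials in $G$). These blocks include the factor $-q$ in their off-diagonal adjacency entries. The vectors in $\mathcal B,\mathcal C,\mathcal D$ are listed in the corresponding vertex orders. $\mathbf{e}_u$ is the characteristic vector of vertex $u$. For a real symmetric matrix $B$, $U_B(t)=\exp(itB)$. *)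

theory Defs
  imports Complex_Main "Jordan_Normal_Form.Matrix"
begin

section \<open>Weighted graphs, involutions and half graphs\<close>

text \<open>An edge is an unordered pair of vertices; a singleton edge is a loop. Loops are permitted,
  so graphs without loops are included as a special case. The weight is only relevant on
  \<open>edges\<close>.\<close>

record 'a wgraph =
  verts :: "'a set"
  edges :: "'a set set"
  weight :: "'a set \<Rightarrow> real"

definition weighted_graph :: "'a wgraph \<Rightarrow> bool" where
  "weighted_graph G \<longleftrightarrow>
     finite (verts G) \<and>
     (\<forall>e\<in>edges G. \<exists>u\<in>verts G. \<exists>v\<in>verts G. e = {u, v}) \<and>
     (\<forall>e\<in>edges G. 0 < weight G e)"

definition adj :: "'a wgraph \<Rightarrow> 'a \<Rightarrow> 'a \<Rightarrow> real" where
  "adj G u v = (if {u, v} \<in> edges G then weight G {u, v} else 0)"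

definition degree :: "'a wgraph \<Rightarrow> 'a \<Rightarrow> real" where
  "degree G u = (\<Sum>v\<in>verts G. adj G u v)"

definition automorphism :: "'a wgraph \<Rightarrow> ('a \<Rightarrow> 'a) \<Rightarrow> bool" where
  "automorphism G \<phi> \<longleftrightarrow>
     bij_betw \<phi> (verts G) (verts G) \<and>
     (\<forall>u\<in>verts G. \<forall>v\<in>verts G. {\<phi> u, \<phi> v} \<in> edges G \<longleftrightarrow> {u, v} \<in> edges G) \<and>
     (\<forall>e\<in>edges G. weight G (\<phi> ` e) = weight G e)"

text \<open>Order exactly two: the identity is excluded.\<close>

definition involution :: "'a wgraph \<Rightarrow> ('a \<Rightarrow> 'a) \<Rightarrow> bool" where
  "involution G \<phi> \<longleftrightarrow>
     automorphism G \<phi> \<and> (\<forall>v\<in>verts G. \<phi> (\<phi> v) = v) \<and> (\<exists>v\<in>verts G. \<phi> v \<noteq> v)"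

definition fixed_verts :: "'a wgraph \<Rightarrow> ('a \<Rightarrow> 'a) \<Rightarrow> 'a set" where
  "fixed_verts G \<phi> = {v \<in> verts G. \<phi> v = v}"

definition induced_subgraph :: "'a wgraph \<Rightarrow> 'a set \<Rightarrow> 'a wgraph" where
  "induced_subgraph G H = G\<lparr>verts := H, edges := {e \<in> edges G. e \<subseteq> H}\<rparr>"

definition half_graph :: "'a wgraph \<Rightarrow> ('a \<Rightarrow> 'a) \<Rightarrow> 'a wgraph \<Rightarrow> bool" where
  "half_graph G \<phi> G' \<longleftrightarrow>
     (\<exists>H. H \<subseteq> verts G - fixed_verts G \<phi> \<and>
          (\<forall>v \<in> verts G - fixed_verts G \<phi>. \<exists>!x. x \<in> H \<and> x \<in> {v, \<phi> v}) \<and>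
          G' = induced_subgraph G H)"


section \<open>Matrices of a graph\<close>

text \<open>A matrix indexed by vertices is taken with respect to a list \<open>vs\<close> that enumerates
  the vertices without repetition.\<close>

definition adj_mat :: "'a wgraph \<Rightarrow> 'a list \<Rightarrow> real mat" where
  "adj_mat G vs = mat (length vs) (length vs) (\<lambda>(i, j). adj G (vs ! i) (vs ! j))"

definition degree_mat :: "'a wgraph \<Rightarrow> 'a list \<Rightarrow> real mat" where
  "degree_mat G vs = mat_diag (length vs) (\<lambda>i. degree G (vs ! i))"

definition potential_mat :: "('a \<Rightarrow> real) \<Rightarrow> 'a list \<Rightarrow> real mat" where
  "potential_mat \<eta> vs = mat_diag (length vs) (\<lambda>i. \<eta> (vs ! i))"

definition q_laplacian :: "'a wgraph \<Rightarrow> ('a \<Rightarrow> real) \<Rightarrow> real \<Rightarrow> 'a list \<Rightarrow> real mat" where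
  "q_laplacian G \<eta> q vs =
     (1 - q\<^sup>2) \<cdot>\<^sub>m 1\<^sub>m (length vs) + q\<^sup>2 \<cdot>\<^sub>m (degree_mat G vs + potential_mat \<eta> vs)
       - q \<cdot>\<^sub>m adj_mat G vs"

text \<open>The contiguous \<open>nr \<times> nc\<close> block whose upper left corner is at row \<open>r\<close>, column \<open>c\<close>.\<close>

definition mat_block :: "'a mat \<Rightarrow> nat \<Rightarrow> nat \<Rightarrow> nat \<Rightarrow> nat \<Rightarrow> 'a mat" where
  "mat_block A r c nr nc = mat nr nc (\<lambda>(i, j). A $$ (r + i, c + j))"

definition char_vec :: "'a list \<Rightarrow> 'a \<Rightarrow> real vec" where
  "char_vec vs u = vec (length vs) (\<lambda>i. if vs ! i = u then 1 else 0)"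

text \<open>The columns are those of the families \<open>\<B>\<close>, \<open>\<C>\<close>, \<open>\<D>\<close>, in this order;
  \<open>us\<close> enumerates the half graph and \<open>ss\<close> the fixed vertices.\<close>

definition involution_basis_mat :: "('a \<Rightarrow> 'a) \<Rightarrow> 'a list \<Rightarrow> 'a list \<Rightarrow> real mat" where
  "involution_basis_mat \<phi> us ss =
     (let vs = us @ map \<phi> us @ ss in
      mat_of_cols (length vs)
       (map (\<lambda>u. (1 / sqrt 2) \<cdot>\<^sub>v (char_vec vs u - char_vec vs (\<phi> u))) us @
        map (\<lambda>u. (1 / sqrt 2) \<cdot>\<^sub>v (char_vec vs u + char_vec vs (\<phi> u))) us @
        map (\<lambda>u. char_vec vs u) ss))"


section \<open>The matrix exponential\<close>

text \<open>The exponential series of a square matrix, summed entrywise. Each entry converges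
  absolutely, see \<open>mat_exp_summable\<close> below.\<close>

definition mat_exp :: "complex mat \<Rightarrow> complex mat" where
  "mat_exp A = mat (dim_row A) (dim_row A) (\<lambda>(i, j). \<Sum>k. (A ^\<^sub>m k) $$ (i, j) / fact k)"

definition transition_mat :: "real mat \<Rightarrow> real \<Rightarrow> complex mat" where
  "transition_mat B t = mat_exp ((\<i> * complex_of_real t) \<cdot>\<^sub>m map_mat complex_of_real B)"

lemma pow_mat_entry_bound:
  assumes A: "A \<in> carrier_mat n n" and c: "\<And>i j. i < n \<Longrightarrow> j < n \<Longrightarrow> norm (A $$ (i, j)) \<le> c"
    and "i < n" "j < n"
  shows "norm ((A ^\<^sub>m k) $$ (i, j) :: complex) \<le> (real n * c) ^ k"
  using assms(3,4)
proof (induction k arbitrary: j)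
  case 0
  then show ?case using A by simp
next
  case (Suc k)
  have c0: "0 \<le> c" using c[OF Suc.prems] norm_ge_zero order_trans by blast
  have P: "A ^\<^sub>m k \<in> carrier_mat n n" using A by simp
  have "(A ^\<^sub>m Suc k) $$ (i, j) = (\<Sum>l\<in>{0..<n}. (A ^\<^sub>m k) $$ (i, l) * A $$ (l, j))"
    using A P Suc.prems by (simp add: scalar_prod_def)
  also have "norm \<dots> \<le> (\<Sum>l\<in>{0..<n}. (real n * c) ^ k * c)"
    using Suc c c0 by (intro sum_norm_le) (auto simp: norm_mult intro!: mult_mono)
  also have "\<dots> = (real n * c) ^ Suc k" by simp
  finally show ?case .
qed

lemma mat_exp_summable:
  assumes A: "A \<in> carrier_mat n n" and ij: "i < n" "j < n"
  shows "summable (\<lambda>k. norm ((A ^\<^sub>m k) $$ (i, j) / fact k :: complex))"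
proof -
  define c where "c = (\<Sum>(i, j)\<in>{..<n} \<times> {..<n}. norm (A $$ (i, j)))"
  have c: "norm (A $$ (i, j)) \<le> c" if "i < n" "j < n" for i j
    using member_le_sum[of "(i, j)" "{..<n} \<times> {..<n}" "\<lambda>(i, j). norm (A $$ (i, j))"] that
    unfolding c_def by auto
  show ?thesis
  proof (rule summable_comparison_test')
    show "summable (\<lambda>k. (real n * c) ^ k / fact k)"
      using summable_exp[of "real n * c"] by (simp add: divide_inverse mult.commute)
    show "norm (norm ((A ^\<^sub>m k) $$ (i, j) / fact k)) \<le> (real n * c) ^ k / fact k" if "k \<ge> 0" for k
      using pow_mat_entry_bound[OF A c ij, of k] by (simp add: norm_divide divide_right_mono)
  qed
qed


section \<open>Block structure of the q-Laplacian\<close>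

lemma vertex_order:
  assumes "involution G \<phi>" and "half_graph G \<phi> G'"
    and "distinct us" "set us = verts G'" and "distinct ss" "set ss = fixed_verts G \<phi>"
  shows "distinct (us @ map \<phi> us @ ss)" and "set (us @ map \<phi> us @ ss) = verts G"
proof -
  obtain H where H: "H \<subseteq> verts G - fixed_verts G \<phi>"
      "\<forall>v \<in> verts G - fixed_verts G \<phi>. \<exists>!x. x \<in> H \<and> x \<in> {v, \<phi> v}"
      "G' = induced_subgraph G H"
    using assms(2) unfolding half_graph_def by (elim exE conjE)
  have us: "set us = H" using assms(4) H(3) by (simp add: induced_subgraph_def)
  have inv: "\<phi> (\<phi> v) = v" "\<phi> v \<in> verts G" if "v \<in> verts G" for v
    using assms(1) that unfolding involution_def automorphism_def by (auto dest: bij_betwE)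
  have inj: "inj_on \<phi> (verts G)" by (metis inj_onI inv(1))
  have nf: "\<phi> v \<noteq> v" if "v \<in> H" for v using H(1) that by (auto simp: fixed_verts_def)
  have nH: "\<phi> v \<notin> H" if "v \<in> H" for v
  proof -
    have "\<exists>!x. x \<in> H \<and> x \<in> {v, \<phi> v}" using H(1,2) that by blast
    then show ?thesis using nf[OF that] that by (metis insertI1 insertI2)
  qed
  have HV: "H \<subseteq> verts G" using H(1) by auto
  have "inj_on \<phi> (set us)" using inj_on_subset[OF inj HV] us by simp
  moreover have "set us \<inter> set ss = {}" using H(1) us assms(6) by auto
  moreover have "set us \<inter> \<phi> ` set us = {}" using nH us by auto
  moreover have "\<phi> ` set us \<inter> set ss = {}"
  proof -
    have "\<phi> u \<notin> set ss" if "u \<in> H" for u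
    proof
      assume "\<phi> u \<in> set ss"
      then have "\<phi> (\<phi> u) = \<phi> u" using assms(6) by (simp add: fixed_verts_def)
      then show False using inv(1)[of u] HV nf that by auto
    qed
    then show ?thesis using us by auto
  qed
  ultimately show "distinct (us @ map \<phi> us @ ss)"
    using assms(3,5) by (simp add: distinct_map Int_Un_distrib)
  have "v \<in> H \<or> v \<in> \<phi> ` H" if v: "v \<in> verts G - fixed_verts G \<phi>" for v
  proof -
    obtain x where "x \<in> H" "x = v \<or> x = \<phi> v" using bspec[OF H(2) v] by blast
    then show ?thesis using inv(1)[of v] v by (metis DiffD1 imageI)
  qed
  then show "set (us @ map \<phi> us @ ss) = verts G"
    using us assms(6) HV inv by (auto simp: fixed_verts_def)
qed

lemma q_laplacian_dim [simp]: "q_laplacian G \<eta> q vs \<in> carrier_mat (length vs) (length vs)"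
  by (rule carrier_matI)
    (simp_all add: q_laplacian_def adj_mat_def degree_mat_def potential_mat_def mat_diag_def)

lemma q_laplacian_index:
  assumes "i < length vs" "j < length vs"
  shows "q_laplacian G \<eta> q vs $$ (i, j) =
    (if i = j then 1 - q\<^sup>2 + q\<^sup>2 * (degree G (vs ! i) + \<eta> (vs ! i)) else 0)
      - q * adj G (vs ! i) (vs ! j)"
  using assms by (simp add: q_laplacian_def adj_mat_def degree_mat_def potential_mat_def mat_diag_def)

lemma adj_commute: "adj G u v = adj G v u"
  by (simp add: adj_def insert_commute)

lemma adj_automorphism:
  assumes "automorphism G \<phi>" "u \<in> verts G" "v \<in> verts G"
  shows "adj G (\<phi> u) (\<phi> v) = adj G u v"
proof -
  have "weight G (\<phi> ` {u, v}) = weight G {u, v}" if "{u, v} \<in> edges G"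
    using assms(1) that unfolding automorphism_def by blast
  moreover have "{\<phi> u, \<phi> v} \<in> edges G \<longleftrightarrow> {u, v} \<in> edges G"
    using assms unfolding automorphism_def by blast
  ultimately show ?thesis by (simp add: adj_def)
qed

lemma degree_automorphism:
  assumes "automorphism G \<phi>" "u \<in> verts G"
  shows "degree G (\<phi> u) = degree G u"
proof -
  have "degree G (\<phi> u) = (\<Sum>v\<in>verts G. adj G (\<phi> u) (\<phi> v))"
    using assms(1) sum.reindex_bij_betw[of \<phi> "verts G" "verts G" "adj G (\<phi> u)"]
    unfolding degree_def automorphism_def by simp
  also have "\<dots> = degree G u"
    using adj_automorphism[OF assms] by (simp add: degree_def)
  finally show ?thesis .
qed

text \<open>The blocks below are read off from the first and last block rows; this lemma shows that the
  remaining ones coincide with them as expected.\<close>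

lemma q_laplacian_blocks:
  fixes G :: "'a wgraph" and us ss :: "'a list" and q :: real
  assumes inv: "involution G \<phi>" and "half_graph G \<phi> G'"
    and \<eta>: "\<And>v. v \<in> verts G \<Longrightarrow> \<eta> v = \<eta> (\<phi> v)"
    and "distinct us" "set us = verts G'" and "distinct ss" "set ss = fixed_verts G \<phi>"
  defines "m \<equiv> length us" and "s \<equiv> length ss"
  defines "L \<equiv> q_laplacian G \<eta> q (us @ map \<phi> us @ ss)"
  defines "L' \<equiv> mat_block L 0 0 m m" and "A\<phi> \<equiv> mat_block L 0 m m m"
    and "AS \<equiv> mat_block L 0 (2 * m) m s" and "LS \<equiv> mat_block L (2 * m) (2 * m) s s"
  shows "L = four_block_mat (four_block_mat L' A\<phi> A\<phi> L') (AS @\<^sub>r AS) (AS @\<^sub>r AS)\<^sup>T LS"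
    and "A\<phi>\<^sup>T = A\<phi>"
proof -
  define vs where "vs = us @ map \<phi> us @ ss"
  have len: "length vs = 2 * m + s" by (simp add: vs_def m_def s_def)
  have set: "set vs = verts G"
    using vertex_order(2)[OF inv assms(2,4-7)] by (simp add: vs_def)
  have aut: "automorphism G \<phi>" using inv by (simp add: involution_def)
  have mem: "u \<in> verts G" if "u \<in> set us \<or> u \<in> set ss" for u
    using set that by (auto simp: vs_def)
  have pp: "\<phi> (\<phi> u) = u" if "u \<in> verts G" for u using inv that by (simp add: involution_def)
  have pin: "\<phi> u \<in> verts G" if "u \<in> verts G" for u
    using aut that by (auto simp: automorphism_def dest: bij_betwE)
  have pS: "\<phi> u = u" if "u \<in> set ss" for u using assms(7) that by (simp add: fixed_verts_def)
  have v1: "vs ! i = us ! i" if "i < m" for i using that by (simp add: vs_def m_def nth_append)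
  have v2: "vs ! (m + i) = \<phi> (us ! i)" if "i < m" for i
    using that by (simp add: vs_def m_def nth_append)
  have v3: "vs ! (2 * m + i) = ss ! i" if "i < s" for i
    using that by (simp add: vs_def m_def s_def nth_append)
  have mu: "us ! i \<in> verts G" if "i < m" for i using mem that by (simp add: m_def)
  have ms: "ss ! i \<in> verts G" if "i < s" for i using mem that by (simp add: s_def)
  have idx: "L $$ (i, j) =
      (if i = j then 1 - q\<^sup>2 + q\<^sup>2 * (degree G (vs ! i) + \<eta> (vs ! i)) else 0)
        - q * adj G (vs ! i) (vs ! j)" if "i < 2 * m + s" "j < 2 * m + s" for i j
    using q_laplacian_index[of i vs j] that len by (simp add: L_def vs_def)
  have sym: "L $$ (i, j) = L $$ (j, i)" if "i < 2 * m + s" "j < 2 * m + s" for i j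
    using that by (simp add: idx adj_commute)
  have adj1: "adj G (\<phi> u) (\<phi> v) = adj G u v" if "u \<in> verts G" "v \<in> verts G" for u v
    using adj_automorphism[OF aut] that by simp
  have adj2: "adj G (\<phi> u) v = adj G u (\<phi> v)" if "u \<in> verts G" "v \<in> verts G" for u v
    using adj1[of u "\<phi> v"] that pin pp by simp
  have b22: "L $$ (m + i, m + j) = L $$ (i, j)" if "i < m" "j < m" for i j
    using that by (simp add: idx v1 v2 mu adj1 degree_automorphism[OF aut] \<eta>[symmetric])
  have b21: "L $$ (m + i, j) = L $$ (i, m + j)" if "i < m" "j < m" for i j
    using that by (simp add: idx v1 v2 mu adj2)
  have b23: "L $$ (m + i, 2 * m + j) = L $$ (i, 2 * m + j)" if "i < m" "j < s" for i j
    using that pS[of "ss ! j"] by (simp add: idx v1 v2 v3 mu ms adj2 s_def)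
  show "A\<phi>\<^sup>T = A\<phi>"
    using b21 sym by (intro eq_matI) (auto simp: A\<phi>_def mat_block_def)
  have dim: "dim_row L = 2 * m + s" "dim_col L = 2 * m + s"
    using q_laplacian_dim[of G \<eta> q vs] len by (auto simp: L_def vs_def)
  define P where "P = four_block_mat L' A\<phi> A\<phi> L'"
  define Q where "Q = AS @\<^sub>r AS"
  have dims: "dim_row P = 2 * m" "dim_col P = 2 * m" "dim_row Q = 2 * m" "dim_col Q = s"
      "dim_row LS = s" "dim_col LS = s"
    by (simp_all add: P_def Q_def L'_def AS_def LS_def mat_block_def append_rows_def)
  have cases2: "k < m \<or> (\<exists>k'<m. k = m + k')" if "k < 2 * m" for k
  proof (cases "k < m")
    case False
    then have "k = m + (k - m)" "k - m < m" using that by linarith+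
    then show ?thesis by blast
  qed simp
  have P: "P $$ (i, j) = L $$ (i, j)" if "i < 2 * m" "j < 2 * m" for i j
  proof -
    have "P $$ (i, j) = (if i < m then if j < m then L' $$ (i, j) else A\<phi> $$ (i, j - m)
        else if j < m then A\<phi> $$ (i - m, j) else L' $$ (i - m, j - m))"
      using that by (simp add: P_def L'_def mat_block_def)
    then show ?thesis
      using cases2[OF that(1)] cases2[OF that(2)] b21 b22
      by (elim disjE exE conjE) (simp_all add: L'_def A\<phi>_def mat_block_def)
  qed
  have Q: "Q $$ (i, j) = L $$ (i, 2 * m + j)" if "i < 2 * m" "j < s" for i j
  proof -
    have "Q $$ (i, j) = (if i < m then AS $$ (i, j) else AS $$ (i - m, j))"
      using that by (simp add: Q_def AS_def mat_block_def append_rows_def)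
    then show ?thesis
      using cases2[OF that(1)] that(2) b23
      by (elim disjE exE conjE) (simp_all add: AS_def mat_block_def)
  qed
  have LS: "LS $$ (i, j) = L $$ (2 * m + i, 2 * m + j)" if "i < s" "j < s" for i j
    using that by (simp add: LS_def mat_block_def)
  have "L = four_block_mat P Q Q\<^sup>T LS"
  proof (rule eq_matI)
    fix i j
    assume "i < dim_row (four_block_mat P Q Q\<^sup>T LS)" "j < dim_col (four_block_mat P Q Q\<^sup>T LS)"
    then have ij: "i < 2 * m + s" "j < 2 * m + s" by (simp_all add: dims)
    have "four_block_mat P Q Q\<^sup>T LS $$ (i, j) =
        (if i < 2 * m then if j < 2 * m then P $$ (i, j) else Q $$ (i, j - 2 * m)
         else if j < 2 * m then Q\<^sup>T $$ (i - 2 * m, j) else LS $$ (i - 2 * m, j - 2 * m))"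
      using ij by (simp add: dims)
    also have "\<dots> = L $$ (i, j)"
    proof (cases "i < 2 * m"; cases "j < 2 * m")
      assume "i < 2 * m" "j < 2 * m" then show ?thesis by (simp add: P)
    next
      assume *: "i < 2 * m" "\<not> j < 2 * m"
      then have "j - 2 * m < s" "2 * m + (j - 2 * m) = j" using ij by linarith+
      then show ?thesis using * Q[of i "j - 2 * m"] by presburger
    next
      assume *: "\<not> i < 2 * m" "j < 2 * m"
      then have i: "i - 2 * m < s" "2 * m + (i - 2 * m) = i" using ij by linarith+
      then have "Q\<^sup>T $$ (i - 2 * m, j) = Q $$ (j, i - 2 * m)" using * dims by simp
      then show ?thesis using * i Q[of j "i - 2 * m"] sym[OF ij] by presburger
    next
      assume *: "\<not> i < 2 * m" "\<not> j < 2 * m"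
      then have "i - 2 * m < s" "2 * m + (i - 2 * m) = i" "j - 2 * m < s" "2 * m + (j - 2 * m) = j"
        using ij by linarith+
      then show ?thesis using * LS[of "i - 2 * m" "j - 2 * m"] by presburger
    qed
    finally show "L $$ (i, j) = four_block_mat P Q Q\<^sup>T LS $$ (i, j)" by simp
  qed (simp_all add: dim dims)
  then show "L = four_block_mat (four_block_mat L' A\<phi> A\<phi> L') (AS @\<^sub>r AS) (AS @\<^sub>r AS)\<^sup>T LS"
    by (simp only: P_def Q_def)
qed

end

theory Submission
  imports Defs "Jordan_Normal_Form.Determinant"
begin

text \<open>
  The columns of the matrix \<open>M\<close> are vectors of odd parity under the involution
  (\<open>\<B>\<close>) followed by vectors of even parity (\<open>\<C>\<close> and \<open>\<D>\<close>).
  They are orthonormal, so \<open>X \<mapsto> M\<^sup>T * X * M\<close> is a change of orthonormal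
  basis. The q-Laplacian \<open>L\<close> commutes with the involution, hence maps each of the two parity
  spaces to itself; \<open>q_laplacian_blocks\<close> expresses this by the repeated blocks. In terms
  of matrices, \<open>M\<^sup>T * L * M\<close> is block diagonal, and its
  diagonal blocks are \<open>L_minus\<close> and \<open>L_plus\<close> (\<open>symmetry_mat_block_diag\<close>).

  The matrix exponential is a power series, so it commutes with similarity
  (\<open>mat_exp_similar\<close>, hence \<open>transition_mat_orthogonal\<close>) and acts separately on the
  blocks of a block diagonal matrix (\<open>transition_mat_block_diag\<close>). Therefore
  \<open>M\<^sup>T * transition_mat L t * M\<close> is the transition matrix of
  \<open>M\<^sup>T * L * M\<close>, which is the block diagonal matrix of the transition matrices of
  \<open>L_minus\<close> and \<open>L_plus\<close>.

  The part about the change of basis only refers to positions: once the vertices are listed as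
  half graph, mirror image, fixed vertices, the matrix \<open>M\<close> depends on the numbers
  \<open>m\<close> and \<open>s\<close> alone.
\<close>

section \<open>Similarity and block diagonal matrices under the exponential\<close>

lemma mat_exp_carrier: "A \<in> carrier_mat n n \<Longrightarrow> mat_exp A \<in> carrier_mat n n"
  by (simp add: mat_exp_def)

lemma mat_exp_sums:
  assumes "A \<in> carrier_mat n n" "i < n" "j < n"
  shows "(\<lambda>k. (A ^\<^sub>m k) $$ (i, j) / fact k) sums (mat_exp A $$ (i, j))"
  using summable_sums[OF summable_norm_cancel[OF mat_exp_summable[OF assms]]] assms
  by (simp add: mat_exp_def)

text \<open>Multiplication by a fixed matrix is a finite linear combination of entries, so it can be
  interchanged with an entrywise convergent series. The divisor \<open>a k\<close> makes room for the
  factorials of the exponential series.\<close>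

lemma sums_mat_mult_left:
  fixes F :: "nat \<Rightarrow> complex mat"
  assumes N: "N \<in> carrier_mat n n" and F: "\<And>k. F k \<in> carrier_mat n n" and E: "E \<in> carrier_mat n n"
    and sums: "\<And>i j. i < n \<Longrightarrow> j < n \<Longrightarrow> (\<lambda>k. F k $$ (i, j) / a k) sums (E $$ (i, j))"
    and ij: "i < n" "j < n"
  shows "(\<lambda>k. (N * F k) $$ (i, j) / a k) sums ((N * E) $$ (i, j))"
proof -
  have "(\<lambda>k. \<Sum>l<n. N $$ (i, l) * (F k $$ (l, j) / a k)) sums (\<Sum>l<n. N $$ (i, l) * E $$ (l, j))"
    using sums ij by (intro sums_sum sums_mult) auto
  moreover have "(N * F k) $$ (i, j) / a k = (\<Sum>l<n. N $$ (i, l) * (F k $$ (l, j) / a k))" for k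
    using N F[of k] ij by (simp add: scalar_prod_def sum_divide_distrib atLeast0LessThan)
  moreover have "(N * E) $$ (i, j) = (\<Sum>l<n. N $$ (i, l) * E $$ (l, j))"
    using N E ij by (simp add: scalar_prod_def atLeast0LessThan)
  ultimately show ?thesis by simp
qed

lemma sums_mat_mult_right:
  fixes F :: "nat \<Rightarrow> complex mat"
  assumes N: "N \<in> carrier_mat n n" and F: "\<And>k. F k \<in> carrier_mat n n" and E: "E \<in> carrier_mat n n"
    and sums: "\<And>i j. i < n \<Longrightarrow> j < n \<Longrightarrow> (\<lambda>k. F k $$ (i, j) / a k) sums (E $$ (i, j))"
    and ij: "i < n" "j < n"
  shows "(\<lambda>k. (F k * N) $$ (i, j) / a k) sums ((E * N) $$ (i, j))"
proof -
  have "(\<lambda>k. \<Sum>l<n. F k $$ (i, l) / a k * N $$ (l, j)) sums (\<Sum>l<n. E $$ (i, l) * N $$ (l, j))"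
    using sums ij by (intro sums_sum sums_mult2) auto
  moreover have "(F k * N) $$ (i, j) / a k = (\<Sum>l<n. F k $$ (i, l) / a k * N $$ (l, j))" for k
    using N F[of k] ij by (simp add: scalar_prod_def sum_divide_distrib atLeast0LessThan)
  moreover have "(E * N) $$ (i, j) = (\<Sum>l<n. E $$ (i, l) * N $$ (l, j))"
    using N E ij by (simp add: scalar_prod_def atLeast0LessThan)
  ultimately show ?thesis by simp
qed

text \<open>In \<open>B = N * A * M\<close> with \<open>M * N = 1\<close> the inner factors cancel in every
  power, \<open>B ^ k = N * A ^ k * M\<close>; the claim is this identity summed over the exponential
  series.\<close>

lemma mat_exp_similar:
  assumes sim: "similar_mat_wit B A N M" and A: "A \<in> carrier_mat n n"
  shows "mat_exp B = N * mat_exp A * M"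
proof -
  have car: "B \<in> carrier_mat n n" "N \<in> carrier_mat n n" "M \<in> carrier_mat n n"
    using similar_mat_witD(4-7)[OF refl sim] A by (metis carrier_matD(1))+
  have pow: "B ^\<^sub>m k = N * A ^\<^sub>m k * M" for k
    by (rule similar_mat_wit_pow_id[OF sim])
  have E: "mat_exp A \<in> carrier_mat n n" using A by (rule mat_exp_carrier)
  show ?thesis
  proof (rule eq_matI)
    fix i j assume "i < dim_row (N * mat_exp A * M)" "j < dim_col (N * mat_exp A * M)"
    then have ij: "i < n" "j < n" using car by simp_all
    have "(\<lambda>k. (N * A ^\<^sub>m k * M) $$ (i, j) / fact k) sums ((N * mat_exp A * M) $$ (i, j))"
      using car A E ij
      by (intro sums_mat_mult_right[where n = n] sums_mat_mult_left[where n = n] mat_exp_sums) auto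
    with mat_exp_sums[OF car(1) ij] show "mat_exp B $$ (i, j) = (N * mat_exp A * M) $$ (i, j)"
      unfolding pow by (rule sums_unique2)
  qed (use car mat_exp_carrier[OF car(1)] in simp_all)
qed

lemma mat_exp_block_diag:
  assumes A: "A \<in> carrier_mat n n" and B: "B \<in> carrier_mat m m"
  shows "mat_exp (four_block_mat A (0\<^sub>m n m) (0\<^sub>m m n) B) =
    four_block_mat (mat_exp A) (0\<^sub>m n m) (0\<^sub>m m n) (mat_exp B)"
proof -
  have "(four_block_mat A (0\<^sub>m n m) (0\<^sub>m m n) B ^\<^sub>m k) $$ (i, j) =
      (if i < n then if j < n then (A ^\<^sub>m k) $$ (i, j) else 0
       else if j < n then 0 else (B ^\<^sub>m k) $$ (i - n, j - n))"
    if "i < n + m" "j < n + m" for i j k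
  proof -
    have "dim_row (A ^\<^sub>m k) = n" "dim_col (A ^\<^sub>m k) = n"
        "dim_row (B ^\<^sub>m k) = m" "dim_col (B ^\<^sub>m k) = m"
      using A B by auto
    then show ?thesis
      using that by (simp add: pow_four_block_mat[OF A B] del: pow_mat_dim)
  qed
  then show ?thesis using A B by (intro eq_matI) (auto simp: mat_exp_def)
qed

lemma transition_mat_carrier: "A \<in> carrier_mat n n \<Longrightarrow> transition_mat A t \<in> carrier_mat n n"
  by (simp add: transition_mat_def mat_exp_carrier)

lemma transition_mat_block_diag:
  assumes A: "A \<in> carrier_mat n n" and B: "B \<in> carrier_mat m m"
  shows "transition_mat (four_block_mat A (0\<^sub>m n m) (0\<^sub>m m n) B) t =
    four_block_mat (transition_mat A t) (0\<^sub>m n m) (0\<^sub>m m n) (transition_mat B t)"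
proof -
  let ?c = "\<lambda>A. (\<i> * complex_of_real t) \<cdot>\<^sub>m map_mat complex_of_real A"
  have "?c (four_block_mat A (0\<^sub>m n m) (0\<^sub>m m n) B) = four_block_mat (?c A) (0\<^sub>m n m) (0\<^sub>m m n) (?c B)"
    using A B by (intro eq_matI) auto
  moreover have "?c A \<in> carrier_mat n n" "?c B \<in> carrier_mat m m" using A B by auto
  ultimately show ?thesis
    unfolding transition_mat_def by (simp only: mat_exp_block_diag)
qed

text \<open>An orthogonal real matrix stays invertible with inverse its transpose when it is read as a
  complex matrix, so this is similarity invariance applied to the complex multiple of
  \<open>A\<close> that the transition matrix exponentiates.\<close>

lemma transition_mat_orthogonal:
  assumes M: "M \<in> carrier_mat n n" and A: "A \<in> carrier_mat n n" and orth: "M\<^sup>T * M = 1\<^sub>m n"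
  defines "C \<equiv> map_mat complex_of_real M"
  shows "transition_mat (M\<^sup>T * A * M) t = C\<^sup>T * transition_mat A t * C"
proof -
  let ?h = "map_mat complex_of_real" and ?z = "\<i> * complex_of_real t"
  have C: "C \<in> carrier_mat n n" "C\<^sup>T = ?h M\<^sup>T" using M by (auto simp: C_def)
  have MT: "M\<^sup>T \<in> carrier_mat n n" using M by simp
  have "C\<^sup>T * C = ?h (M\<^sup>T * M)"
    unfolding C(2) unfolding C_def by (rule of_real_hom.mat_hom_mult[OF MT M, symmetric])
  then have 1: "C\<^sup>T * C = 1\<^sub>m n" by (simp add: orth of_real_hom.mat_hom_one)
  have 2: "C * C\<^sup>T = 1\<^sub>m n" by (rule mat_mult_left_right_inverse[OF _ C(1) 1]) (use C(1) in simp)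
  have CT: "C\<^sup>T \<in> carrier_mat n n" and hA: "?h A \<in> carrier_mat n n" using C(1) A by simp_all
  have "?z \<cdot>\<^sub>m ?h (M\<^sup>T * A * M) = ?z \<cdot>\<^sub>m (C\<^sup>T * ?h A * C)"
    unfolding C(2) unfolding C_def
    by (simp only: of_real_hom.mat_hom_mult[OF mult_carrier_mat[OF MT A] M]
        of_real_hom.mat_hom_mult[OF MT A])
  also have "\<dots> = C\<^sup>T * (?z \<cdot>\<^sub>m ?h A) * C"
    by (simp only: mult_smult_distrib[OF CT hA]
        mult_smult_assoc_mat[OF mult_carrier_mat[OF CT hA] C(1)])
  finally have "similar_mat_wit (?z \<cdot>\<^sub>m ?h (M\<^sup>T * A * M)) (?z \<cdot>\<^sub>m ?h A) C\<^sup>T C"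
    using C A M 1 2 by (intro similar_mat_witI[where n = n]) auto
  then show ?thesis
    unfolding transition_mat_def by (rule mat_exp_similar[where n = n]) (use A in auto)
qed

section \<open>The change of basis given by the symmetry\<close>

text \<open>This is the matrix \<open>M\<close> in terms of positions instead of vertices: position
  \<open>m + k\<close> holds the mirror image of position \<open>k < m\<close>, and the last \<open>s\<close>
  positions are fixed. Column \<open>j\<close> with \<open>m \<le> j < 2 * m\<close> belongs to the pair
  \<open>j - m\<close> and \<open>j\<close>.\<close>

definition symmetry_mat :: "nat \<Rightarrow> nat \<Rightarrow> real mat" where
  "symmetry_mat m s = mat (2 * m + s) (2 * m + s) (\<lambda>(k, j).
     if j < m then (of_bool (k = j) - of_bool (k = m + j)) / sqrt 2
     else if j < 2 * m then (of_bool (k = j - m) + of_bool (k = j)) / sqrt 2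
     else of_bool (k = j))"

lemma three_block_cases:
  fixes i m s :: nat
  assumes "i < 2 * m + s"
  obtains "i < m" | k where "i = m + k" "k < m" | k where "i = 2 * m + k" "k < s"
proof -
  have "i < m \<or> i = m + (i - m) \<and> i - m < m \<or> i = 2 * m + (i - 2 * m) \<and> i - 2 * m < s"
    using assms by linarith
  then show thesis using that by metis
qed

lemma involution_basis_mat_eq:
  assumes "distinct (us @ map \<phi> us @ ss)"
  shows "involution_basis_mat \<phi> us ss = symmetry_mat (length us) (length ss)"
proof -
  define m s vs where "m = length us" and "s = length ss" and "vs = us @ map \<phi> us @ ss"
  have len: "length vs = 2 * m + s" by (simp add: vs_def m_def s_def)
  have dist: "vs ! k = vs ! l \<longleftrightarrow> k = l" if "k < 2 * m + s" "l < 2 * m + s" for k l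
    using assms that len by (simp add: vs_def nth_eq_iff_index_eq)
  have v1: "us ! j = vs ! j" and v2: "\<phi> (us ! j) = vs ! (m + j)" if "j < m" for j
    using that by (simp_all add: vs_def m_def nth_append)
  have v3: "ss ! j = vs ! (2 * m + j)" for j
    by (simp add: vs_def m_def nth_append)
  have char_vec: "char_vec vs (vs ! l) = vec (2 * m + s) (\<lambda>k. of_bool (k = l))"
    if "l < 2 * m + s" for l
    using that by (intro eq_vecI) (simp_all add: char_vec_def len dist)
  define cs where
    "cs = map (\<lambda>u. (1 / sqrt 2) \<cdot>\<^sub>v (char_vec vs u - char_vec vs (\<phi> u))) us @
      map (\<lambda>u. (1 / sqrt 2) \<cdot>\<^sub>v (char_vec vs u + char_vec vs (\<phi> u))) us @
      map (\<lambda>u. char_vec vs u) ss"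
  have cs_len: "length cs = 2 * m + s" by (simp add: cs_def m_def s_def)
  have c1: "cs ! j = (1 / sqrt 2) \<cdot>\<^sub>v (char_vec vs (vs ! j) - char_vec vs (vs ! (m + j)))"
    and c2: "cs ! (m + j) = (1 / sqrt 2) \<cdot>\<^sub>v (char_vec vs (vs ! j) + char_vec vs (vs ! (m + j)))"
    if "j < m" for j
    using that by (simp_all add: cs_def nth_append m_def flip: v1[unfolded m_def] v2[unfolded m_def])
  have c3: "cs ! (2 * m + j) = char_vec vs (vs ! (2 * m + j))" if "j < s" for j
    using that by (simp add: cs_def nth_append m_def s_def flip: v3[unfolded m_def])
  have "mat_of_cols (2 * m + s) cs = symmetry_mat m s"
  proof (rule eq_matI)
    fix k j assume "k < dim_row (symmetry_mat m s)" "j < dim_col (symmetry_mat m s)"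
    then have kj: "k < 2 * m + s" "j < 2 * m + s" by (simp_all add: symmetry_mat_def)
    show "mat_of_cols (2 * m + s) cs $$ (k, j) = symmetry_mat m s $$ (k, j)"
      by (rule three_block_cases[OF kj(2)])
        (use kj in \<open>simp_all add: mat_of_cols_index cs_len c1 c2 c3 char_vec symmetry_mat_def\<close>)
  qed (simp_all add: symmetry_mat_def cs_len)
  then show ?thesis
    unfolding involution_basis_mat_def Let_def
    by (simp only: vs_def[symmetric] cs_def[symmetric] len m_def s_def)
qed

text \<open>The inner product of the vector \<open>f\<close> with column \<open>j\<close> of
  \<open>symmetry_mat\<close>, without the sum over all positions; see \<open>sum_symmetry_mat\<close>.\<close>

definition symmetry_coord :: "nat \<Rightarrow> nat \<Rightarrow> (nat \<Rightarrow> real) \<Rightarrow> real" where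
  "symmetry_coord m j f = (if j < m then (f j - f (m + j)) / sqrt 2
     else if j < 2 * m then (f (j - m) + f j) / sqrt 2 else f j)"

lemma sum_symmetry_mat:
  assumes "j < 2 * m + s"
  shows "(\<Sum>k<2 * m + s. symmetry_mat m s $$ (k, j) * f k) = symmetry_coord m j f"
proof -
  have "(\<Sum>k<2 * m + s. of_bool (k = l) * f k) = f l" if "l < 2 * m + s" for l
    using that by (simp add: of_bool_def if_distrib[of "\<lambda>x. x * _"] cong: if_cong)
  then show ?thesis using assms
    by (auto simp: symmetry_mat_def symmetry_coord_def algebra_simps sum.distrib sum_subtractf
        simp flip: sum_divide_distrib)
qed

text \<open>Each entry of the conjugated matrix involves at most four entries of \<open>B\<close>. Both
  orthogonality and block diagonalisation are read off from this formula.\<close>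

lemma symmetry_mat_conj_index:
  assumes B: "B \<in> carrier_mat (2 * m + s) (2 * m + s)" and ij: "i < 2 * m + s" "j < 2 * m + s"
  shows "((symmetry_mat m s)\<^sup>T * B * symmetry_mat m s) $$ (i, j) =
    symmetry_coord m j (\<lambda>l. symmetry_coord m i (\<lambda>k. B $$ (k, l)))"
proof -
  let ?n = "2 * m + s" and ?M = "symmetry_mat m s"
  have M: "?M \<in> carrier_mat ?n ?n" by (simp add: symmetry_mat_def)
  define N where "N = ?M\<^sup>T * B"
  have N: "N \<in> carrier_mat ?n ?n" using M B by (simp add: N_def)
  have "N $$ (i, l) = symmetry_coord m i (\<lambda>k. B $$ (k, l))" if "l < ?n" for l
    using M B that ij by (simp add: N_def scalar_prod_def atLeast0LessThan sum_symmetry_mat)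
  then have "(N * ?M) $$ (i, j) = (\<Sum>l<?n. ?M $$ (l, j) * symmetry_coord m i (\<lambda>k. B $$ (k, l)))"
    using M N ij by (simp add: scalar_prod_def atLeast0LessThan mult.commute)
  then show ?thesis using ij by (simp add: sum_symmetry_mat N_def)
qed

lemma symmetry_coord_simps:
  "j < m \<Longrightarrow> symmetry_coord m j f = (f j - f (m + j)) / sqrt 2"
  "j < m \<Longrightarrow> symmetry_coord m (m + j) f = (f j + f (m + j)) / sqrt 2"
  "symmetry_coord m (2 * m + j) f = f (2 * m + j)"
  by (simp_all add: symmetry_coord_def)

lemma symmetry_mat_orthogonal: "(symmetry_mat m s)\<^sup>T * symmetry_mat m s = 1\<^sub>m (2 * m + s)"
proof -
  let ?n = "2 * m + s" and ?M = "symmetry_mat m s"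
  have M: "?M \<in> carrier_mat ?n ?n" by (simp add: symmetry_mat_def)
  \<comment> \<open>The identity in the middle makes the formula for conjugated matrices applicable.\<close>
  have "(?M\<^sup>T * 1\<^sub>m ?n * ?M) $$ (i, j) = 1\<^sub>m ?n $$ (i, j)" if ij: "i < ?n" "j < ?n" for i j
    unfolding symmetry_mat_conj_index[OF one_carrier_mat ij]
    by (rule three_block_cases[OF ij(1)]; rule three_block_cases[OF ij(2)])
      (simp_all add: symmetry_coord_simps)
  then have "?M\<^sup>T * 1\<^sub>m ?n * ?M = 1\<^sub>m ?n"
    using M by (intro eq_matI) auto
  then show ?thesis using M by simp
qed

text \<open>In an odd row and an even column the contributions of \<open>P\<close>, \<open>A\<close> and
  \<open>Q\<close> occur once with each sign and cancel; in the diagonal blocks they reinforce each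
  other. Two normalising factors \<open>1 / sqrt 2\<close> average the two copies of \<open>P\<close> and
  of \<open>A\<close>, whereas only one such factor meets the two copies of \<open>Q\<close>, which leaves
  the factor \<open>sqrt 2\<close>.\<close>

lemma symmetry_mat_block_diag:
  fixes P A Q R :: "real mat"
  assumes P: "P \<in> carrier_mat m m" and A: "A \<in> carrier_mat m m" and Q: "Q \<in> carrier_mat m s"
    and R: "R \<in> carrier_mat s s"
  defines "L \<equiv> four_block_mat (four_block_mat P A A P) (Q @\<^sub>r Q) (Q @\<^sub>r Q)\<^sup>T R"
  shows "(symmetry_mat m s)\<^sup>T * L * symmetry_mat m s =
    four_block_mat (P - A) (0\<^sub>m m (m + s)) (0\<^sub>m (m + s) m)
      (four_block_mat (P + A) (sqrt 2 \<cdot>\<^sub>m Q) (sqrt 2 \<cdot>\<^sub>m Q\<^sup>T) R)" (is "_ = ?D")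
proof (rule eq_matI)
  have L: "L \<in> carrier_mat (2 * m + s) (2 * m + s)"
    using P A Q R by (intro carrier_matI) (simp_all add: L_def append_rows_def)
  fix i j assume "i < dim_row ?D" "j < dim_col ?D"
  then have ij: "i < 2 * m + s" "j < 2 * m + s" using P A R by auto
  have idx:
    "k < m \<Longrightarrow> l < m \<Longrightarrow> L $$ (k, l) = P $$ (k, l)"
    "k < m \<Longrightarrow> l < m \<Longrightarrow> L $$ (k, m + l) = A $$ (k, l)"
    "k < m \<Longrightarrow> l < m \<Longrightarrow> L $$ (m + k, l) = A $$ (k, l)"
    "k < m \<Longrightarrow> l < m \<Longrightarrow> L $$ (m + k, m + l) = P $$ (k, l)"
    "k < m \<Longrightarrow> l < s \<Longrightarrow> L $$ (k, 2 * m + l) = Q $$ (k, l)"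
    "k < m \<Longrightarrow> l < s \<Longrightarrow> L $$ (m + k, 2 * m + l) = Q $$ (k, l)"
    "k < s \<Longrightarrow> l < m \<Longrightarrow> L $$ (2 * m + k, l) = Q $$ (l, k)"
    "k < s \<Longrightarrow> l < m \<Longrightarrow> L $$ (2 * m + k, m + l) = Q $$ (l, k)"
    "k < s \<Longrightarrow> l < s \<Longrightarrow> L $$ (2 * m + k, 2 * m + l) = R $$ (k, l)" for k l
    using P A Q R by (simp_all add: L_def append_rows_def)
  have half: "x / sqrt 2 / sqrt 2 = x / 2" "2 * x / sqrt 2 = sqrt 2 * x" for x :: real
    by (simp_all add: field_simps)
  show "((symmetry_mat m s)\<^sup>T * L * symmetry_mat m s) $$ (i, j) = ?D $$ (i, j)"
    unfolding symmetry_mat_conj_index[OF L ij]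
    by (rule three_block_cases[OF ij(1)]; rule three_block_cases[OF ij(2)])
      (use P A Q R in \<open>simp_all add: symmetry_coord_simps idx half flip: diff_divide_distrib add_divide_distrib\<close>)
qed (use P A Q R in \<open>auto simp: symmetry_mat_def\<close>)

section \<open>The transition matrix of a graph with an involution\<close>

theorem theorem2:
  fixes G G' :: "'a wgraph" and \<phi> :: "'a \<Rightarrow> 'a" and \<eta> :: "'a \<Rightarrow> real" and q t :: real
    and us ss :: "'a list"
  assumes "weighted_graph G"
    and "involution G \<phi>"
    and "half_graph G \<phi> G'"
    and "\<And>v. v \<in> verts G \<Longrightarrow> \<eta> v = \<eta> (\<phi> v)"
    and "q \<noteq> 0"
    and "distinct us" and "set us = verts G'"
    and "distinct ss" and "set ss = fixed_verts G \<phi>"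
  shows "let m = length us; s = length ss;
             L = q_laplacian G \<eta> q (us @ map \<phi> us @ ss);
             L' = mat_block L 0 0 m m;
             A\<phi> = mat_block L 0 m m m;
             AS = mat_block L 0 (2 * m) m s;
             LS = mat_block L (2 * m) (2 * m) s s;
             L_minus = L' - A\<phi>;
             L_plus = four_block_mat (L' + A\<phi>) (sqrt 2 \<cdot>\<^sub>m AS) (sqrt 2 \<cdot>\<^sub>m AS\<^sup>T) LS;
             M = map_mat complex_of_real (involution_basis_mat \<phi> us ss)
         in M\<^sup>T * transition_mat L t * M =
            four_block_mat (transition_mat L_minus t) (0\<^sub>m m (m + s))
                           (0\<^sub>m (m + s) m) (transition_mat L_plus t)"
proof -
  define L where "L = q_laplacian G \<eta> q (us @ map \<phi> us @ ss)"
  define m s where "m = length us" and "s = length ss"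
  define L' A\<phi> AS LS where "L' = mat_block L 0 0 m m" and "A\<phi> = mat_block L 0 m m m"
    and "AS = mat_block L 0 (2 * m) m s" and "LS = mat_block L (2 * m) (2 * m) s s"
  note defs = L'_def A\<phi>_def AS_def LS_def
  define Lp where "Lp = four_block_mat (L' + A\<phi>) (sqrt 2 \<cdot>\<^sub>m AS) (sqrt 2 \<cdot>\<^sub>m AS\<^sup>T) LS"
  have car: "L' \<in> carrier_mat m m" "A\<phi> \<in> carrier_mat m m" "AS \<in> carrier_mat m s"
    "LS \<in> carrier_mat s s" by (simp_all add: defs mat_block_def)
  have Lp: "Lp \<in> carrier_mat (m + s) (m + s)"
    using car by (simp add: Lp_def)
  have L: "L \<in> carrier_mat (2 * m + s) (2 * m + s)"
    using q_laplacian_dim[of G \<eta> q "us @ map \<phi> us @ ss"] by (simp add: L_def m_def s_def mult_2 add.assoc)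
  have M: "involution_basis_mat \<phi> us ss = symmetry_mat m s"
    unfolding m_def s_def
    by (rule involution_basis_mat_eq[OF vertex_order(1)[OF assms(2,3,6-9)]])
  have blocks: "L = four_block_mat (four_block_mat L' A\<phi> A\<phi> L') (AS @\<^sub>r AS) (AS @\<^sub>r AS)\<^sup>T LS"
    unfolding defs m_def s_def L_def
    by (rule q_laplacian_blocks(1)[OF assms(2,3) _ assms(6-9)]) (rule assms(4))
  have diag: "(symmetry_mat m s)\<^sup>T * L * symmetry_mat m s =
      four_block_mat (L' - A\<phi>) (0\<^sub>m m (m + s)) (0\<^sub>m (m + s) m) Lp"
    unfolding Lp_def by (subst blocks) (rule symmetry_mat_block_diag[OF car])
  have "(map_mat complex_of_real (symmetry_mat m s))\<^sup>T * transition_mat L t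
      * map_mat complex_of_real (symmetry_mat m s) =
      transition_mat ((symmetry_mat m s)\<^sup>T * L * symmetry_mat m s) t"
    by (rule transition_mat_orthogonal[OF _ L symmetry_mat_orthogonal, symmetric])
      (simp add: symmetry_mat_def)
  also have "\<dots> = four_block_mat (transition_mat (L' - A\<phi>) t) (0\<^sub>m m (m + s))
      (0\<^sub>m (m + s) m) (transition_mat Lp t)"
    unfolding diag using car Lp by (intro transition_mat_block_diag) auto
  finally show ?thesis
    unfolding Let_def M Lp_def defs L_def m_def s_def by (simp only: M m_def s_def)
qed

end
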